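(* For every deterministic online algorithm $Alg$ for Endpoint Capacitated Flow Scheduling that is allowed to split jobs, there exists an instance in which every node has unit capacity and every job has unit demand such that the maximum response time of the schedule produced by $Alg$ is $\Omega(n)$ times the maximum response time achieved by an optimal (offline) schedule that does not split jobs, where $n$ is the number of nodes.
   Context: Endpoint Capacitated Flow Scheduling: there is a set of $n$ nodes, each node $v$ having a positive integer capacity $c_v$. Time proceeds in discrete rounds. Jobs (flows) arrive over time; each job $j$ is specified by an ordered pair of distinct nodes $(u_j,v_j)$ (its endpoints), a positive integer demand $d_j$, and a release round $r_j$. A schedule assigns, in each round $t \ge r_j$, a nonnegative amount $x_j(t)$ of processing to each released job $j$, subject to the constraint that for every node $v$ and every round $t$, the sum of $x_j(t)$ over all jobs $j$ having $v$ as an endpoint is at most $c_v$. A job is completed in the round in which the total amount assigned to it reaches its demand $d_j$. If jobs are splittable, a job may be processed fractionally over several rounds; if jobs are unsplittable, each job must be processed entirely (amount $d_j$) in a single round. The response time of job $j$ is its completion round minus its release round $r_j$, and the maximum response time of a schedule is the maximum of the response times over all jobs. An online algorithm decides the assignment for round $t$ knowing only the jobs released in rounds up to $t$. *)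

theory Defs
  imports "HOL-Library.Extended_Real"
begin

text \<open>The field \<open>tag\<close> carries no meaning: it lets an instance contain several jobs
  with the same endpoints, demand and release round.\<close>

record job =
  tag :: nat
  src :: nat
  dst :: nat
  demand :: nat
  release :: nat

record flow_instance =
  nodes :: "nat set"
  capacity :: "nat \<Rightarrow> nat"
  jobs :: "job set"

definition valid_instance :: "flow_instance \<Rightarrow> bool" where
  "valid_instance I \<longleftrightarrow>
     finite (nodes I) \<and> (\<forall>v\<in>nodes I. 0 < capacity I v) \<and>
     finite (jobs I) \<and>
     (\<forall>j\<in>jobs I. src j \<in> nodes I \<and> dst j \<in> nodes I \<and> src j \<noteq> dst j \<and> 0 < demand j)"

text \<open>\<open>x t j\<close> is the amount of processing given to job \<open>j\<close> in round \<open>t\<close>.\<close>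

type_synonym schedule = "nat \<Rightarrow> job \<Rightarrow> real"

definition feasible :: "flow_instance \<Rightarrow> schedule \<Rightarrow> bool" where
  "feasible I x \<longleftrightarrow>
     (\<forall>j\<in>jobs I. \<forall>t. 0 \<le> x t j) \<and>
     (\<forall>j\<in>jobs I. \<forall>t<release j. x t j = 0) \<and>
     (\<forall>v\<in>nodes I. \<forall>t. (\<Sum>j | j \<in> jobs I \<and> (src j = v \<or> dst j = v). x t j) \<le> real (capacity I v))"

definition unsplit :: "flow_instance \<Rightarrow> schedule \<Rightarrow> bool" where
  "unsplit I x \<longleftrightarrow>
     (\<forall>j\<in>jobs I. \<exists>t. x t j = real (demand j) \<and> (\<forall>s. s \<noteq> t \<longrightarrow> x s j = 0))"

text \<open>A job that never receives its full demand has completion round \<open>\<infinity>\<close>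
  (the infimum of the empty set), hence infinite response time.\<close>

definition completion :: "schedule \<Rightarrow> job \<Rightarrow> enat" where
  "completion x j = (INF t \<in> {t. real (demand j) \<le> (\<Sum>s\<le>t. x s j)}. enat t)"

definition response :: "schedule \<Rightarrow> job \<Rightarrow> enat" where
  "response x j = completion x j - enat (release j)"

definition max_response :: "flow_instance \<Rightarrow> schedule \<Rightarrow> enat" where
  "max_response I x = (SUP j \<in> jobs I. response x j)"

definition opt_unsplit :: "flow_instance \<Rightarrow> enat" where
  "opt_unsplit I = (INF x \<in> {x. feasible I x \<and> unsplit I x}. max_response I x)"

definition released_by :: "flow_instance \<Rightarrow> nat \<Rightarrow> flow_instance" where
  "released_by I t = I\<lparr>jobs := {j \<in> jobs I. release j \<le> t}\<rparr>"

text \<open>A deterministic online algorithm is a function that maps the part of the instance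
  known in round \<open>t\<close>, and \<open>t\<close> itself, to the assignment for round \<open>t\<close>. Its own earlier
  decisions need not be passed to it, since they are determined by the same data.\<close>

type_synonym algorithm = "flow_instance \<Rightarrow> nat \<Rightarrow> job \<Rightarrow> real"

definition run :: "algorithm \<Rightarrow> flow_instance \<Rightarrow> schedule" where
  "run A I = (\<lambda>t. A (released_by I t) t)"

definition online_algorithm :: "algorithm \<Rightarrow> bool" where
  "online_algorithm A \<longleftrightarrow> (\<forall>I. valid_instance I \<longrightarrow> feasible I (run A I))"

end

theory Submission imports Defs begin

text \<open>Suppose the algorithm finishes every job within \<open>D\<close> rounds on all instances whose optimum is at
  most 2. Call the work still owed to the jobs at a node its lag. A node that receives one new job
  in every round cannot reduce its lag, while jobs older than \<open>D\<close> rounds are gone; so the lag of a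
  node can be copied to any partner, and hence to many nodes, by loading the connecting pair for
  \<open>D + 1\<close> rounds.

  To increase the lag, take \<open>m\<close> nodes \<open>s\<^sub>1, \<dots>, s\<^sub>m\<close> of lag \<open>\<beta>\<close> and arrange them on a path
  \<open>c\<^sub>0 s\<^sub>1 c\<^sub>1 \<dots> s\<^sub>m c\<^sub>m\<close>. Over \<open>2m + 1\<close> rounds each \<open>s\<^sub>i\<close> receives \<open>2m + 2\<close> jobs along the path, so the
  \<open>m + 1\<close> nodes \<open>c\<^sub>k\<close> end up with total lag at least \<open>m(\<beta> + 1)\<close>. The jobs are released such that
  for every \<open>k\<close> some schedule of maximum response 2 has by then finished all jobs at \<open>c\<^sub>k\<close> and postponed
  only one job of each \<open>s\<^sub>i\<close>. The adversary commits to the \<open>c\<^sub>k\<close> of largest lag, which is at least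
  \<open>\<beta> + 1/2\<close> as long as \<open>\<beta> \<le> (m - 1)/2\<close>. Iterating gives a lag of \<open>m/2\<close>, but no lag exceeds \<open>D\<close>.\<close>

section \<open>Unit instances and offline schedules of response at most 2\<close>

definition at_node :: "nat \<Rightarrow> job \<Rightarrow> bool" where
  "at_node v j \<longleftrightarrow> src j = v \<or> dst j = v"

definition unit_job :: "nat \<Rightarrow> nat \<Rightarrow> nat \<Rightarrow> job" where
  "unit_job u v t = \<lparr>tag = 0, src = u, dst = v, demand = 1, release = t\<rparr>"

lemma unit_job_simps [simp]:
  "tag (unit_job u v t) = 0" "src (unit_job u v t) = u" "dst (unit_job u v t) = v"
  "demand (unit_job u v t) = 1" "release (unit_job u v t) = t"
  "at_node x (unit_job u v t) \<longleftrightarrow> u = x \<or> v = x"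
  "unit_job u v t = unit_job u' v' t' \<longleftrightarrow> u = u' \<and> v = v' \<and> t = t'"
  by (auto simp: unit_job_def at_node_def)

definition unit_instance :: "nat \<Rightarrow> job set \<Rightarrow> flow_instance" where
  "unit_instance n J = \<lparr>nodes = {..<n}, capacity = (\<lambda>_. 1), jobs = J\<rparr>"

definition unit_jobs :: "nat \<Rightarrow> job set \<Rightarrow> bool" where
  "unit_jobs n J \<longleftrightarrow>
     finite J \<and> (\<forall>j\<in>J. src j < n \<and> dst j < n \<and> src j \<noteq> dst j \<and> demand j = 1)"

lemma valid_unit_instance: "unit_jobs n J \<Longrightarrow> valid_instance (unit_instance n J)"
  by (auto simp: valid_instance_def unit_instance_def unit_jobs_def)

text \<open>Encodes an unsplit unit-capacity schedule with all responses at most 2; the adversary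
  maintains one alongside its jobs.\<close>

definition assignment :: "job set \<Rightarrow> (job \<Rightarrow> nat) \<Rightarrow> bool" where
  "assignment J \<sigma> \<longleftrightarrow>
     (\<forall>j\<in>J. release j \<le> \<sigma> j \<and> \<sigma> j \<le> release j + 2) \<and>
     (\<forall>i\<in>J. \<forall>j\<in>J. \<forall>v. i \<noteq> j \<longrightarrow> at_node v i \<longrightarrow> at_node v j \<longrightarrow> \<sigma> i \<noteq> \<sigma> j)"

lemma opt_unsplit_le_2:
  assumes J: "unit_jobs n J" and \<sigma>: "assignment J \<sigma>"
  shows "opt_unsplit (unit_instance n J) \<le> 2"
proof -
  define x :: schedule where "x = (\<lambda>t j. if t = \<sigma> j then 1 else 0)"
  have fin: "finite J" using J by (simp add: unit_jobs_def)
  have cap: "(\<Sum>j | j \<in> J \<and> (src j = v \<or> dst j = v). x t j) \<le> 1" for v t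
  proof -
    let ?S = "{j \<in> J. at_node v j \<and> \<sigma> j = t}"
    have "(\<Sum>j | j \<in> J \<and> (src j = v \<or> dst j = v). x t j) = (\<Sum>j\<in>?S. 1)"
      by (rule sum.mono_neutral_cong_right) (use fin in \<open>auto simp: x_def at_node_def\<close>)
    also have "\<dots> = real (card ?S)" by simp
    also have "card ?S \<le> 1"
      using \<sigma> fin unfolding assignment_def One_nat_def by (subst card_le_Suc0_iff_eq) (simp, blast)
    finally show ?thesis by simp
  qed
  have "feasible (unit_instance n J) x"
    using \<sigma> cap by (auto simp: feasible_def unit_instance_def x_def assignment_def)
  moreover have "unsplit (unit_instance n J) x"
    using J by (auto simp: unsplit_def unit_instance_def x_def unit_jobs_def)
  moreover have "max_response (unit_instance n J) x \<le> 2"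
    unfolding max_response_def
  proof (rule SUP_least)
    fix j assume "j \<in> jobs (unit_instance n J)"
    then have j: "j \<in> J" by (simp add: unit_instance_def)
    have "completion x j \<le> enat (\<sigma> j)"
      unfolding completion_def
      by (rule INF_lower) (use J j in \<open>auto simp: unit_jobs_def x_def\<close>)
    also have "\<dots> \<le> enat (release j + 2)"
      using \<sigma> j by (auto simp: assignment_def)
    finally obtain k where "completion x j = enat k" "k \<le> release j + 2"
      by (cases "completion x j") auto
    then show "response x j \<le> 2"
      by (simp add: response_def numeral_eq_enat)
  qed
  ultimately show ?thesis
    unfolding opt_unsplit_def by (intro INF_lower2[of x]) auto
qed

text \<open>Two unit jobs released in round 0 at one unit-capacity node cannot both be finished in
  that round.\<close>

lemma opt_unsplit_pos:
  assumes fin: "finite J" and n: "0 < n"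
    and pq: "p \<in> J" "q \<in> J" "p \<noteq> q" "at_node 0 p" "at_node 0 q"
      "demand p = 1" "demand q = 1" "release p = 0" "release q = 0"
  shows "0 < opt_unsplit (unit_instance n J)"
proof -
  have "1 \<le> max_response (unit_instance n J) x" if x: "feasible (unit_instance n J) x" for x
  proof (rule ccontr)
    assume "\<not> 1 \<le> max_response (unit_instance n J) x"
    then have z: "max_response (unit_instance n J) x = 0"
      by (simp add: not_le one_eSuc)
    have ge: "1 \<le> x 0 j" if j: "j \<in> J" "demand j = 1" "release j = 0" for j
    proof -
      have "response x j \<le> 0"
        unfolding z[symmetric] max_response_def
        by (rule SUP_upper) (use j in \<open>simp add: unit_instance_def\<close>)
      then have c: "completion x j = 0"
        using j by (cases "completion x j") (auto simp: response_def enat_0)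
      let ?W = "{t. real (demand j) \<le> (\<Sum>s\<le>t. x s j)}"
      \<comment> \<open>The infimum defining \<open>completion\<close> is attained once the set is
        nonempty, so completion 0 means that round 0 alone covers the demand.\<close>
      have "completion x j \<in> enat ` ?W"
      proof -
        have "?W \<noteq> {}"
        proof
          assume "?W = {}"
          then have "completion x j = \<infinity>"
            unfolding completion_def by (simp add: top_enat_def)
          with c show False by simp
        qed
        then show ?thesis unfolding completion_def by (intro wellorder_InfI[of "enat (SOME t. t \<in> ?W)"]) (auto intro: someI)
      qed
      with c have "0 \<in> ?W" by (auto simp: zero_enat_def)
      with j show ?thesis by simp
    qed
    have nn: "\<forall>j\<in>J. 0 \<le> x 0 j"
      and cap: "(\<Sum>j | j \<in> J \<and> (src j = 0 \<or> dst j = 0). x 0 j) \<le> 1"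
      using x n by (auto simp: feasible_def unit_instance_def)
    have "x 0 p + x 0 q = (\<Sum>j\<in>{p, q}. x 0 j)" using pq by simp
    also have "\<dots> \<le> (\<Sum>j | j \<in> J \<and> (src j = 0 \<or> dst j = 0). x 0 j)"
      by (rule sum_mono2) (use pq fin nn in \<open>auto simp: at_node_def\<close>)
    finally show False using cap ge[of p] ge[of q] pq by simp
  qed
  then have "1 \<le> opt_unsplit (unit_instance n J)"
    unfolding opt_unsplit_def by (intro INF_greatest) auto
  then show ?thesis using less_le_trans[OF zero_less_one] by blast
qed

text \<open>Old jobs are served before \<open>T\<close> and new ones from \<open>T\<close> on, so
  only two new jobs can conflict.\<close>

lemma assignment_extend:
  assumes \<sigma>: "assignment J \<sigma>" and clean: "\<forall>j\<in>J. \<sigma> j < T" and inj: "inj_on f Q"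
    and rel: "\<And>q. q \<in> Q \<Longrightarrow> T \<le> release (f q) \<and> release (f q) \<le> \<tau> q \<and> \<tau> q \<le> release (f q) + 2"
    and conf: "\<And>p q v. \<lbrakk>p \<in> Q; q \<in> Q; p \<noteq> q; at_node v (f p); at_node v (f q)\<rbrakk> \<Longrightarrow> \<tau> p \<noteq> \<tau> q"
  shows "\<exists>\<sigma>'. assignment (J \<union> f ` Q) \<sigma>' \<and> (\<forall>j\<in>J. \<sigma>' j = \<sigma> j) \<and> (\<forall>q\<in>Q. \<sigma>' (f q) = \<tau> q)"
proof -
  define \<sigma>' where "\<sigma>' = (\<lambda>j. if j \<in> J then \<sigma> j else \<tau> (inv_into Q f j))"
  have old: "\<sigma>' j = \<sigma> j" if "j \<in> J" for j using that by (simp add: \<sigma>'_def)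
  have notJ: "f q \<notin> J" if "q \<in> Q" for q
  proof
    assume "f q \<in> J"
    then have "release (f q) < T" using \<sigma> clean unfolding assignment_def by (meson le_less_trans)
    then show False using rel[OF that] by simp
  qed
  then have new: "\<sigma>' (f q) = \<tau> q" if "q \<in> Q" for q
    using that inj by (simp add: \<sigma>'_def)
  have lt: "\<sigma>' i < \<sigma>' (f q)" if "i \<in> J" "q \<in> Q" for i q
    using rel[of q] clean that by (fastforce simp: old new)
  have "\<sigma>' i \<noteq> \<sigma>' j" if ij: "i \<in> J \<union> f ` Q" "j \<in> J \<union> f ` Q" "i \<noteq> j" "at_node v i" "at_node v j" for i j v
  proof -
    consider "i \<in> J" "j \<in> J" | q where "i \<in> J" "q \<in> Q" "j = f q" | q where "j \<in> J" "q \<in> Q" "i = f q"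
      | p q where "p \<in> Q" "q \<in> Q" "i = f p" "j = f q"
      using ij(1,2) by blast
    then show ?thesis
    proof cases
      case 1 then show ?thesis using \<sigma> ij(3-) by (auto simp: assignment_def old)
    next
      case 2 then show ?thesis using lt by (metis less_irrefl)
    next
      case 3 then show ?thesis using lt by (metis less_irrefl)
    next
      case 4 then show ?thesis using conf[of p q v] ij(3-) by (auto simp: new)
    qed
  qed
  moreover have "\<forall>j\<in>J \<union> f ` Q. release j \<le> \<sigma>' j \<and> \<sigma>' j \<le> release j + 2"
    using \<sigma> rel by (auto simp: assignment_def old new)
  ultimately show ?thesis
    by (intro exI[of _ \<sigma>']) (simp add: assignment_def old new)
qed

section \<open>The path gadget and its offline schedules\<close>

text \<open>A triple \<open>(i, r, t)\<close> stands for a job released in round \<open>t\<close> between \<open>s\<^sub>i\<close> and its right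
  neighbour \<open>c\<^sub>i\<close> (if \<open>r\<close>) or its left neighbour \<open>c\<^sub>i\<^sub>-\<^sub>1\<close>. In round 0 both are released, in later even
  rounds all right ones, and in round \<open>2j - 1\<close> the left ones for \<open>i \<le> j\<close> and the right ones for
  \<open>i > j\<close>.\<close>

definition path_slots :: "nat \<Rightarrow> (nat \<times> bool \<times> nat) set" where
  "path_slots m = {(i, r, t). 1 \<le> i \<and> i \<le> m \<and> t \<le> 2 * m \<and>
     (if r then even t \<or> t + 3 \<le> 2 * i else t = 0 \<or> odd t \<and> 2 * i \<le> t + 1)}"

text \<open>The schedule that finishes \<open>c\<^sub>k\<close> first. Every \<open>s\<^sub>i\<close> is always one job behind. The pending job is
  the latest right one, and for \<open>i \<le> k\<close> from round \<open>2k - 1\<close> on, where the pending right job is served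
  in place of the new left one, the latest left one. The remaining pending jobs, none of which is at
  \<open>c\<^sub>k\<close>, are served in round \<open>2m + 1\<close>.\<close>

fun path_round :: "nat \<Rightarrow> nat \<Rightarrow> nat \<times> bool \<times> nat \<Rightarrow> nat" where
  "path_round m k (i, r, t) =
     (if r then
        (if i \<le> k \<and> 2 * k \<le> t then t
         else if t + 2 < 2 * i \<or> t = 2 * m \<or> i \<le> k \<and> t + 2 = 2 * k then t + 1
         else t + 2)
      else if i \<le> k \<and> 2 * k \<le> t + 1 then t + 2
      else t)"

text \<open>Whether \<open>s\<^sub>i\<close> is served to its right in round \<open>t\<close>. Monotonicity in \<open>i\<close> means that no
  \<open>c\<^sub>i\<close> is served from both sides.\<close>

definition path_side :: "nat \<Rightarrow> nat \<Rightarrow> nat \<Rightarrow> nat \<Rightarrow> bool" where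
  "path_side m k i t \<longleftrightarrow> 0 < t \<and>
     (if t = 2 * m + 1 then k < i else even t \<or> t + 3 \<le> 2 * i \<or> i \<le> k \<and> t + 1 = 2 * k)"

lemma path_slotsE:
  assumes "(i, r, t) \<in> path_slots m"
  obtains a where "r" "t = 2 * a" "a \<le> m" "1 \<le> i" "i \<le> m"
  | a where "r" "t = 2 * a + 1" "a + 2 \<le> i" "1 \<le> i" "i \<le> m"
  | "\<not> r" "t = 0" "1 \<le> i" "i \<le> m"
  | a where "\<not> r" "t = 2 * a + 1" "a < m" "i \<le> a + 1" "1 \<le> i" "i \<le> m"
proof (cases "even t")
  case True
  then show ?thesis using assms that(1,3) by (auto simp: path_slots_def split: if_splits)
next
  case False
  then obtain a where "t = 2 * a + 1" by (elim oddE)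
  moreover from this have "a < m" using assms by (auto simp: path_slots_def)
  ultimately show ?thesis using assms that(2)[of a] that(4)[of a]
    by (auto simp: path_slots_def split: if_splits)
qed

lemma path_round_bounds:
  assumes q: "(i, r, t) \<in> path_slots m" and k: "k \<le> m"
  shows "t \<le> path_round m k (i, r, t)" "path_round m k (i, r, t) \<le> t + 2"
    "path_round m k (i, r, t) \<le> 2 * m + 1"
proof -
  show "t \<le> path_round m k (i, r, t)" "path_round m k (i, r, t) \<le> t + 2" by simp_all
  show "path_round m k (i, r, t) \<le> 2 * m + 1"
    using q by (cases rule: path_slotsE) (use k in auto)
qed

text \<open>The side served depends only on \<open>i\<close> and the round, so a right and a left
  job of the same \<open>i\<close> never collide.\<close>

lemma path_side_path_round:
  assumes q: "(i, r, t) \<in> path_slots m" and k: "k \<le> m"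
  shows "path_side m k i (path_round m k (i, r, t)) \<longleftrightarrow> r"
  using q
proof (cases rule: path_slotsE)
  case (1 a)
  then show ?thesis using k
    by (auto simp: path_side_def Suc_double_not_eq_double double_not_eq_Suc_double; presburger)
next
  case (2 a)
  then show ?thesis using k
    by (auto simp: path_side_def Suc_double_not_eq_double double_not_eq_Suc_double)
next
  case 3
  then show ?thesis using k by (auto simp: path_side_def)
next
  case (4 a)
  then show ?thesis using k
    by (auto simp: path_side_def Suc_double_not_eq_double double_not_eq_Suc_double)
qed

lemma path_side_Suc: "path_side m k i t \<Longrightarrow> path_side m k (Suc i) t"
  by (auto simp: path_side_def split: if_splits)

text \<open>Excludes collisions within one side; \<open>path_side_path_round\<close> handles those
  between the two sides.\<close>

lemma path_round_less:
  assumes q: "(i, r, t) \<in> path_slots m" and q': "(i, r, t') \<in> path_slots m" and "t < t'" "k \<le> m"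
  shows "path_round m k (i, r, t) < path_round m k (i, r, t')"
  using q
proof (cases rule: path_slotsE)
  case (1 a)
  show ?thesis using q' by (cases rule: path_slotsE) (use 1 assms(3,4) in auto)
next
  case (2 a)
  then show ?thesis using assms(3,4) by auto
next
  case 3
  show ?thesis using q' by (cases rule: path_slotsE) (use 3 assms(3,4) in auto)
next
  case (4 a)
  then show ?thesis using assms(3,4) by auto
qed

lemma path_round_distinct_same_source:
  assumes "(i, r, t) \<in> path_slots m" "(i, r', t') \<in> path_slots m" "(r, t) \<noteq> (r', t')" "k \<le> m"
  shows "path_round m k (i, r, t) \<noteq> path_round m k (i, r', t')"
proof (cases "r = r'")
  case True
  then have "t < t' \<or> t' < t" using assms(3) by auto
  then show ?thesis
    using True assms path_round_less[of i r t m t' k] path_round_less[of i r t' m t k]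
    by (auto simp del: path_round.simps)
next
  case False
  then show ?thesis
    using path_side_path_round[OF assms(1,4)] path_side_path_round[OF assms(2,4)]
    by (auto simp del: path_round.simps)
qed

text \<open>If the rounds agreed, \<open>path_side\<close> would hold at \<open>i\<close> and fail
  at \<open>Suc i\<close>, against monotonicity.\<close>

lemma path_round_distinct_same_sink:
  assumes "(i, True, t) \<in> path_slots m" "(Suc i, False, t') \<in> path_slots m" "k \<le> m"
  shows "path_round m k (i, True, t) \<noteq> path_round m k (Suc i, False, t')"
  using path_side_path_round[OF assms(1,3)] path_side_path_round[OF assms(2,3)]
    path_side_Suc[of m k i "path_round m k (i, True, t)"]
  by (auto simp del: path_round.simps)

text \<open>In round \<open>2 * m + 1\<close> the indices up to \<open>k\<close> are served only to
  the left and the others only to the right, which leaves out \<open>c\<^sub>k\<close>.\<close>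

lemma path_round_free_sink:
  assumes "(i, r, t) \<in> path_slots m" "i = (if r then k else Suc k)" "k \<le> m"
  shows "path_round m k (i, r, t) \<noteq> 2 * m + 1"
  using path_side_path_round[OF assms(1,3)] assms(2)
  by (auto simp: path_side_def simp del: path_round.simps split: if_splits)

text \<open>One job in each of \<open>2 * m + 1\<close> rounds, plus a second one in round 0. This
  surplus job is the source of the gain in lag.\<close>

lemma path_slots_row:
  assumes "1 \<le> i" "i \<le> m"
  shows "{q \<in> path_slots m. fst q = i} =
    insert (i, False, 0) ((\<lambda>t. (i, even t \<or> t + 3 \<le> 2 * i, t)) ` {..2 * m})"
proof -
  have "2 * i \<le> t + 1 \<longleftrightarrow> \<not> t + 3 \<le> 2 * i" if "odd t" for t using that by presburger
  then show ?thesis using assms unfolding path_slots_def by (auto split: if_splits)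
qed

lemma card_path_slots_row:
  assumes "1 \<le> i" "i \<le> m"
  shows "card {q \<in> path_slots m. fst q = i} = 2 * m + 2"
  unfolding path_slots_row[OF assms]
  by (subst card_insert_disjoint) (auto simp: card_image inj_on_def)

lemma finite_path_slots: "finite (path_slots m)"
  by (rule finite_subset[of _ "{..m} \<times> UNIV \<times> {..2 * m}"]) (auto simp: path_slots_def)

section \<open>Lag of a prompt online algorithm\<close>

lemma sum_split_at:
  fixes g :: "nat \<Rightarrow> real"
  shows "T \<le> T' \<Longrightarrow> (\<Sum>s<T'. g s) = (\<Sum>s<T. g s) + (\<Sum>s=T..<T'. g s)"
  by (simp add: lessThan_atLeast0 sum.atLeastLessThan_concat)

text \<open>The assumption to be refuted. \<open>J0\<close> is kept inside every instance; it will
  be the pair of jobs that makes the optimum positive.\<close>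

locale prompt_algorithm =
  fixes A :: algorithm and n D :: nat and J0 :: "job set"
  assumes online: "online_algorithm A"
    and prompt: "\<And>J \<sigma> j. \<lbrakk>unit_jobs n J; J0 \<subseteq> J; assignment J \<sigma>; j \<in> J\<rbrakk>
      \<Longrightarrow> 1 \<le> (\<Sum>s\<le>release j + D. run A (unit_instance n J) s j)"
begin

abbreviation work :: "job set \<Rightarrow> schedule" where
  "work J \<equiv> run A (unit_instance n J)"

text \<open>Truncation is needed because a feasible schedule may give a job more than its demand.\<close>

definition remaining :: "job set \<Rightarrow> nat \<Rightarrow> job \<Rightarrow> real" where
  "remaining J T j = max 0 (1 - (\<Sum>s<T. work J s j))"

definition lag :: "job set \<Rightarrow> nat \<Rightarrow> nat \<Rightarrow> real" where
  "lag J T v = (\<Sum>j | j \<in> J \<and> at_node v j. remaining J T j)"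

text \<open>A state from which the adversary can continue: offline, everything is done before round
  \<open>T\<close>, so later jobs can be scheduled independently.\<close>

definition settled :: "job set \<Rightarrow> nat \<Rightarrow> bool" where
  "settled J T \<longleftrightarrow> unit_jobs n J \<and> J0 \<subseteq> J \<and> (\<exists>\<sigma>. assignment J \<sigma> \<and> (\<forall>j\<in>J. \<sigma> j < T))"

lemma settled_release: "settled J T \<Longrightarrow> j \<in> J \<Longrightarrow> release j < T"
  unfolding settled_def assignment_def by (meson le_less_trans)

lemma work_feasible:
  assumes "unit_jobs n J"
  shows work_nonneg: "j \<in> J \<Longrightarrow> 0 \<le> work J t j"
    and work_before_release: "j \<in> J \<Longrightarrow> t < release j \<Longrightarrow> work J t j = 0"
    and work_capacity: "v < n \<Longrightarrow> (\<Sum>j | j \<in> J \<and> at_node v j. work J t j) \<le> 1"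
  using online valid_unit_instance[OF assms]
  by (auto simp: online_algorithm_def feasible_def unit_instance_def at_node_def)

text \<open>This is where being online enters: \<open>released_by\<close> hides later releases, so
  rounds before \<open>T\<close> cannot react to them.\<close>

lemma work_extend:
  assumes "J \<subseteq> J'" "\<And>j. j \<in> J' - J \<Longrightarrow> T \<le> release j" "t < T"
  shows "work J' t = work J t"
proof -
  have "{j \<in> J'. release j \<le> t} = {j \<in> J. release j \<le> t}"
    using assms by fastforce
  then show ?thesis by (simp add: run_def released_by_def unit_instance_def)
qed

lemma remaining_nonneg: "0 \<le> remaining J T j"
  by (simp add: remaining_def)

lemma lag_nonneg: "0 \<le> lag J T v"
  unfolding lag_def by (intro sum_nonneg remaining_nonneg)

lemma work_interval_capacity:
  assumes "unit_jobs n J" "v < n"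
  shows "(\<Sum>j | j \<in> J \<and> at_node v j. \<Sum>s=T..<T'. work J s j) \<le> real (T' - T)"
proof -
  have "(\<Sum>j | j \<in> J \<and> at_node v j. \<Sum>s=T..<T'. work J s j)
      = (\<Sum>s=T..<T'. \<Sum>j | j \<in> J \<and> at_node v j. work J s j)"
    by (rule sum.swap)
  also have "\<dots> \<le> (\<Sum>s=T..<T'. 1)"
    by (intro sum_mono work_capacity assms)
  finally show ?thesis by simp
qed

text \<open>Each round removes at most one unit of work at \<open>v\<close>, while each new job
  brings a full unit.\<close>

lemma lag_extend:
  assumes J': "unit_jobs n J'" and sub: "J \<subseteq> J'"
    and late: "\<And>j. j \<in> J' - J \<Longrightarrow> T \<le> release j"
    and v: "v < n" and T: "T \<le> T'" and k: "k \<le> card {j \<in> J' - J. at_node v j}"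
  shows "lag J T v + real k \<le> lag J' T' v + real (T' - T)"
proof -
  have fin: "finite J'" using J' by (simp add: unit_jobs_def)
  let ?w = "\<lambda>j. \<Sum>s=T..<T'. work J' s j"
  have old: "remaining J T j \<le> remaining J' T' j + ?w j" if "j \<in> J" for j
  proof -
    have "(\<Sum>s<T. work J' s j) = (\<Sum>s<T. work J s j)"
      by (intro sum.cong) (use work_extend[OF sub late] in auto)
    moreover have "0 \<le> ?w j" by (intro sum_nonneg work_nonneg[OF J']) (use sub that in auto)
    ultimately show ?thesis by (simp add: remaining_def sum_split_at[OF T])
  qed
  have new: "1 \<le> remaining J' T' j + ?w j" if "j \<in> J' - J" for j
  proof -
    have "(\<Sum>s<T. work J' s j) = 0"
      by (intro sum.neutral) (use late[OF that] that in \<open>auto intro!: work_before_release[OF J']\<close>)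
    then show ?thesis by (simp add: remaining_def sum_split_at[OF T])
  qed
  let ?O = "{j. j \<in> J \<and> at_node v j}" and ?N = "{j \<in> J' - J. at_node v j}"
  have un: "{j. j \<in> J' \<and> at_node v j} = ?O \<union> ?N" using sub by auto
  have "lag J T v + real k \<le> lag J T v + real (card ?N)" using k by simp
  also have "\<dots> = (\<Sum>j\<in>?O. remaining J T j) + (\<Sum>j\<in>?N. 1)" by (simp add: lag_def)
  also have "\<dots> \<le> (\<Sum>j\<in>?O. remaining J' T' j + ?w j) + (\<Sum>j\<in>?N. remaining J' T' j + ?w j)"
    by (intro add_mono sum_mono old new) auto
  also have "\<dots> = (\<Sum>j\<in>?O \<union> ?N. remaining J' T' j + ?w j)"
    by (rule sum.union_disjoint[symmetric]) (use fin sub in \<open>auto intro: finite_subset\<close>)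
  also have "\<dots> = lag J' T' v + (\<Sum>j\<in>?O \<union> ?N. ?w j)"
    by (simp add: sum.distrib lag_def un)
  also have "\<dots> \<le> lag J' T' v + real (T' - T)"
    using work_interval_capacity[OF J' v, of T T'] by (simp add: un)
  finally show ?thesis .
qed

lemma remaining_expired:
  assumes "unit_jobs n J" "J0 \<subseteq> J" "assignment J \<sigma>" "j \<in> J" "release j + D < T"
  shows "remaining J T j = 0"
proof -
  have "1 \<le> (\<Sum>s\<le>release j + D. work J s j)" using prompt assms by blast
  also have "\<dots> \<le> (\<Sum>s<T. work J s j)"
    by (rule sum_mono2) (use assms in \<open>auto intro: work_nonneg\<close>)
  finally show ?thesis by (simp add: remaining_def)
qed

text \<open>All jobs were released before \<open>T\<close>, so their remaining work must fit into
  the \<open>D\<close> rounds from \<open>T\<close> on.\<close>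

lemma lag_le_deadline:
  assumes s: "settled J T" and v: "v < n"
  shows "lag J T v \<le> real D"
proof -
  obtain \<sigma> where J: "unit_jobs n J" "J0 \<subseteq> J" "assignment J \<sigma>"
    using s by (auto simp: settled_def)
  have "remaining J T j \<le> (\<Sum>s=T..<T + D. work J s j)" if j: "j \<in> J" for j
  proof -
    have "1 \<le> (\<Sum>s\<le>release j + D. work J s j)" using prompt J j by blast
    also have "\<dots> \<le> (\<Sum>s<T + D. work J s j)"
      by (rule sum_mono2) (use settled_release[OF s j] J j in \<open>auto intro: work_nonneg\<close>)
    finally show ?thesis
      using sum_split_at[of T "T + D" "\<lambda>s. work J s j"] J j
      by (auto simp: remaining_def intro!: sum_nonneg work_nonneg)
  qed
  then have "lag J T v \<le> (\<Sum>j | j \<in> J \<and> at_node v j. \<Sum>s=T..<T + D. work J s j)"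
    unfolding lag_def by (intro sum_mono) auto
  also have "\<dots> \<le> real D" using work_interval_capacity[OF J(1) v, of T "T + D"] by simp
  finally show ?thesis .
qed

lemma lag_double:
  assumes s: "settled J T" and W: "W \<subseteq> {..<n}" and g: "inj_on g W" "g ` W \<subseteq> {..<n}" "W \<inter> g ` W = {}"
    and lag: "\<And>v. v \<in> W \<Longrightarrow> \<beta> \<le> lag J T v"
  shows "\<exists>J' T'. settled J' T' \<and> (\<forall>v\<in>W \<union> g ` W. \<beta> \<le> lag J' T' v)"
proof -
  obtain \<sigma> where J: "unit_jobs n J" "J0 \<subseteq> J" "assignment J \<sigma>" "\<forall>j\<in>J. \<sigma> j < T"
    using s by (auto simp: settled_def)
  let ?Q = "W \<times> {..D}" and ?T = "T + D + 1"
  define f where "f = (\<lambda>(a, i). unit_job a (g a) (T + i))"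
  let ?J = "J \<union> f ` ?Q"
  have finW: "finite W" using W finite_subset by blast
  have ne: "a \<noteq> g b" if "a \<in> W" "b \<in> W" for a b using that g(3) by auto
  have inj: "inj_on f ?Q" by (auto simp: f_def inj_on_def)
  \<comment> \<open>Offline, each new job is served in its release round; the pairs
    \<open>a\<close>, \<open>g a\<close> are disjoint.\<close>
  have "\<exists>\<sigma>'. assignment ?J \<sigma>' \<and> (\<forall>j\<in>J. \<sigma>' j = \<sigma> j) \<and> (\<forall>q\<in>?Q. \<sigma>' (f q) = T + snd q)"
  proof (rule assignment_extend[OF J(3,4) inj])
    fix p q v assume *: "p \<in> ?Q" "q \<in> ?Q" "p \<noteq> q" "at_node v (f p)" "at_node v (f q)"
    then have "fst p = fst q"
      using ne inj_onD[OF g(1)] by (auto simp: f_def split: prod.splits)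
    then show "T + snd p \<noteq> T + snd q" using * by (simp add: prod_eq_iff)
  qed (auto simp: f_def)
  then obtain \<sigma>' where \<sigma>': "assignment ?J \<sigma>'" "\<forall>j\<in>J. \<sigma>' j = \<sigma> j" "\<forall>q\<in>?Q. \<sigma>' (f q) = T + snd q"
    by blast
  have unit: "unit_jobs n ?J"
    using J(1) W g(2) ne finW by (auto simp: unit_jobs_def f_def)
  have settled: "settled ?J ?T"
    unfolding settled_def using unit J(2,4) \<sigma>' by (fastforce intro!: exI[of _ \<sigma>'])
  have src: "\<beta> \<le> lag ?J ?T a" if a: "a \<in> W" for a
  proof -
    have "card (f ` ({a} \<times> {..D})) \<le> card {j \<in> ?J - J. at_node a j}"
    proof (rule card_mono)
      show "f ` ({a} \<times> {..D}) \<subseteq> {j \<in> ?J - J. at_node a j}"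
        using a settled_release[OF s] by (fastforce simp: f_def)
    qed (use unit in \<open>auto simp: unit_jobs_def\<close>)
    moreover have "card (f ` ({a} \<times> {..D})) = D + 1"
      by (subst card_image) (use a in \<open>auto intro!: inj_on_subset[OF inj] simp: card_cartesian_product\<close>)
    ultimately have "lag J T a + real (D + 1) \<le> lag ?J ?T a + real (?T - T)"
      by (intro lag_extend[OF unit]) (use a W in \<open>auto simp: f_def\<close>)
    then show ?thesis using lag[OF a] by simp
  qed
  have expired: "remaining ?J ?T j = 0" if "j \<in> J" for j
    by (rule remaining_expired[OF unit _ \<sigma>'(1)]) (use that J(2) settled_release[OF s that] in auto)
  have "\<beta> \<le> lag ?J ?T (g a)" if a: "a \<in> W" for a
  proof -
    \<comment> \<open>The old jobs have expired, so the lag of \<open>a\<close> stems only from jobs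
      whose other end is \<open>g a\<close>.\<close>
    have "lag ?J ?T a = (\<Sum>j | j \<in> f ` ?Q \<and> at_node a j. remaining ?J ?T j)"
      unfolding lag_def
      by (rule sum.mono_neutral_right) (use unit expired in \<open>auto simp: unit_jobs_def\<close>)
    also have "\<dots> \<le> lag ?J ?T (g a)"
      unfolding lag_def
      by (rule sum_mono2) (use unit a ne[OF a, THEN not_sym] in \<open>auto simp: unit_jobs_def f_def remaining_nonneg\<close>)
    finally show ?thesis using src[OF a] by simp
  qed
  then show ?thesis using src settled by blast
qed

text \<open>Repeated doubling, keeping only \<open>Suc k\<close> of the \<open>k + k\<close> nodes
  obtained; the bound on \<open>n\<close> leaves enough partners outside \<open>W\<close>.\<close>

lemma lag_spread:
  assumes s: "settled J T" and v: "v < n" "\<beta> \<le> lag J T v" and k: "1 \<le> k" "2 * k \<le> n"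
  shows "\<exists>J' T' W. settled J' T' \<and> W \<subseteq> {..<n} \<and> card W = k \<and> (\<forall>w\<in>W. \<beta> \<le> lag J' T' w)"
  using k
proof (induction k rule: dec_induct)
  case base
  show ?case using s v by (intro exI[of _ J] exI[of _ T] exI[of _ "{v}"]) auto
next
  case (step k)
  then obtain J' T' W where W: "settled J' T'" "W \<subseteq> {..<n}" "card W = k" "\<forall>w\<in>W. \<beta> \<le> lag J' T' w"
    by auto
  have fin: "finite W" using W(2) finite_subset by blast
  have "card W \<le> card ({..<n} - W)"
    using W(2,3) fin step by (simp add: card_Diff_subset)
  then obtain g where g: "g ` W \<subseteq> {..<n} - W" "inj_on g W"
    using fin by (metis card_le_inj finite_Diff finite_lessThan)
  obtain J'' T'' where J'': "settled J'' T''" "\<forall>v\<in>W \<union> g ` W. \<beta> \<le> lag J'' T'' v"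
    using lag_double[OF W(1,2) g(2), of \<beta>] g(1) W(4) by blast
  have "card (W \<union> g ` W) = k + k"
    using g W(3) fin by (subst card_Un_disjoint) (auto simp: card_image)
  then obtain W' where "W' \<subseteq> W \<union> g ` W" "card W' = Suc k"
    using step by (metis One_nat_def add_le_mono le_refl obtain_subset_with_card_n plus_1_eq_Suc)
  then show ?case using J'' W(2) g(1) by (intro exI[of _ J''] exI[of _ T''] exI[of _ W']) blast
qed

lemma lag_gain:
  fixes s c :: "nat \<Rightarrow> nat"
  assumes st: "settled J T" and D: "D \<le> 2 * m"
    and s: "inj_on s {1..m}" "s ` {1..m} \<subseteq> {..<n}"
    and c: "inj_on c {..m + 1}" "c ` {..m + 1} \<subseteq> {..<n}"
    and disj: "s ` {1..m} \<inter> c ` {..m + 1} = {}"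
    and lag: "\<And>i. i \<in> {1..m} \<Longrightarrow> \<beta> \<le> lag J T (s i)"
  shows "\<exists>J' T' v. settled J' T' \<and> v < n \<and> real m * (\<beta> + 1) / real (m + 1) \<le> lag J' T' v"
proof -
  obtain \<sigma> where J: "unit_jobs n J" "J0 \<subseteq> J" "assignment J \<sigma>" "\<forall>j\<in>J. \<sigma> j < T"
    using st by (auto simp: settled_def)
  let ?Q = "path_slots m" and ?T = "T + (2 * m + 1)"
  \<comment> \<open>Index of the right or left neighbour of \<open>s i\<close> on the path.\<close>
  define d where "d = (\<lambda>i r. if r then i else i - 1 :: nat)"
  define f where "f = (\<lambda>(i, r, t). unit_job (s i) (c (d i r)) (T + t))"
  define J1 where "J1 = J \<union> f ` ?Q"
  have slot: "1 \<le> i" "i \<le> m" "t \<le> 2 * m" "d i r \<le> m" if "(i, r, t) \<in> ?Q" for i r t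
    using that by (auto simp: path_slots_def d_def split: if_splits)
  have ne: "s i \<noteq> c k" if "1 \<le> i" "i \<le> m" "k \<le> m + 1" for i k
    using that disj by (metis IntI atLeastAtMost_iff atMost_iff empty_iff imageI)
  have s_eq: "s i = s i' \<longleftrightarrow> i = i'" if "1 \<le> i" "i \<le> m" "1 \<le> i'" "i' \<le> m" for i i'
    using inj_on_eq_iff[OF s(1)] that by simp
  have c_eq: "c k = c k' \<longleftrightarrow> k = k'" if "k \<le> m + 1" "k' \<le> m + 1" for k k'
    using inj_on_eq_iff[OF c(1)] that by simp
  have d_eq: "d i r = d i r' \<longleftrightarrow> r = r'" if "1 \<le> i" for i r r'
    using that by (auto simp: d_def)
  have inj: "inj_on f ?Q"
  proof (rule inj_onI)
    fix p q assume *: "p \<in> ?Q" "q \<in> ?Q" "f p = f q"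
    obtain i r t i' r' t' where pq: "p = (i, r, t)" "q = (i', r', t')" by (cases p, cases q)
    note sp = slot[OF *(1)[unfolded pq]] and sq = slot[OF *(2)[unfolded pq]]
    have "i = i'" using *(3) sp sq s_eq by (simp add: pq f_def)
    moreover have "d i r = d i' r'" "t = t'"
      using *(3) sp sq c_eq by (auto simp: pq f_def)
    ultimately show "p = q" using sp d_eq by (auto simp: pq)
  qed
  have unit: "unit_jobs n J1"
  proof -
    have "src (f q) < n \<and> dst (f q) < n \<and> src (f q) \<noteq> dst (f q) \<and> demand (f q) = 1" if "q \<in> ?Q" for q
    proof -
      obtain i r t where q: "q = (i, r, t)" by (cases q)
      note sl = slot[OF that[unfolded q]]
      have "s i < n" "c (d i r) < n" using sl s(2) c(2) by (simp_all add: image_subset_iff)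
      then show ?thesis using ne[of i "d i r"] sl by (simp add: q f_def)
    qed
    then show ?thesis using J(1) finite_path_slots by (auto simp: unit_jobs_def J1_def)
  qed
  \<comment> \<open>The jobs \<open>J1\<close> are the same for all \<open>k\<close>; only the
    offline schedule varies, so \<open>k\<close> can be chosen after the algorithm has
    acted.\<close>
  have sched: "\<exists>\<sigma>'. assignment J1 \<sigma>' \<and> (\<forall>j\<in>J. \<sigma>' j = \<sigma> j) \<and> (\<forall>q\<in>?Q. \<sigma>' (f q) = T + path_round m k q)"
    if k: "k \<le> m" for k
    unfolding J1_def
  proof (rule assignment_extend[OF J(3,4) inj])
    fix q assume q: "q \<in> ?Q"
    show "T \<le> release (f q) \<and> release (f q) \<le> T + path_round m k q
        \<and> T + path_round m k q \<le> release (f q) + 2"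
      using path_round_bounds(1,2)[OF _ k] q by (auto simp: f_def simp del: path_round.simps split: prod.splits)
  next
    fix p q v assume *: "p \<in> ?Q" "q \<in> ?Q" "p \<noteq> q" "at_node v (f p)" "at_node v (f q)"
    obtain i r t i' r' t' where pq: "p = (i, r, t)" "q = (i', r', t')" by (cases p, cases q)
    note sp = slot[OF *(1)[unfolded pq]] and sq = slot[OF *(2)[unfolded pq]]
    \<comment> \<open>Jobs meeting at a node share their \<open>s\<close> or their \<open>c\<close>.
      If only the latter, they are a right job of one index and a left job of the next.\<close>
    have "i = i' \<or> d i r = d i' r'"
      using *(4,5) sp sq s_eq[of i i'] c_eq[of "d i r" "d i' r'"] ne[of i "d i' r'"] ne[of i' "d i r"]
      by (auto simp: pq f_def)
    then consider "i = i'" | "r" "\<not> r'" "i' = Suc i" | "\<not> r" "r'" "i = Suc i'"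
      using sp sq by (fastforce simp: d_def split: if_splits)
    then have "path_round m k p \<noteq> path_round m k q"
    proof cases
      case 1 then show ?thesis
        using path_round_distinct_same_source[of i r t m r' t' k] * k by (auto simp: pq)
    next
      case 2 then show ?thesis
        using path_round_distinct_same_sink[of i t m t' k] * k by (auto simp: pq)
    next
      case 3 then show ?thesis
        using path_round_distinct_same_sink[of i' t' m t k] * k by (fastforce simp: pq)
    qed
    then show "T + path_round m k p \<noteq> T + path_round m k q" by simp
  qed
  have late: "T \<le> release j" if "j \<in> J1 - J" for j
    using that by (auto simp: J1_def f_def)
  have new: "f q \<notin> J" if "q \<in> ?Q" for q
    using settled_release[OF st, of "f q"] by (auto simp: f_def split: prod.splits)
  have src: "\<beta> + 1 \<le> lag J1 ?T (s i)" if i: "i \<in> {1..m}" for i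
  proof -
    let ?R = "{q \<in> ?Q. fst q = i}"
    have "2 * m + 2 = card (f ` ?R)"
      using i by (subst card_image) (auto intro!: inj_on_subset[OF inj] simp: card_path_slots_row)
    also have "\<dots> \<le> card {j \<in> J1 - J. at_node (s i) j}"
    proof (rule card_mono)
      have "at_node (s i) (f q)" if "fst q = i" for q
        using that by (auto simp: f_def split: prod.splits)
      then show "f ` ?R \<subseteq> {j \<in> J1 - J. at_node (s i) j}"
        using new by (auto simp: J1_def)
    qed (use unit in \<open>auto simp: unit_jobs_def\<close>)
    finally have "lag J T (s i) + real (2 * m + 2) \<le> lag J1 ?T (s i) + real (?T - T)"
      by (intro lag_extend[OF unit _ late]) (use i s(2) in \<open>auto simp: J1_def image_subset_iff\<close>)
    then show ?thesis using lag[OF i] by simp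
  qed
  have expired: "remaining J1 ?T j = 0" if "j \<in> J" for j
  proof -
    \<comment> \<open>Any \<open>k\<close> would do, as promptness just needs some
      \<open>assignment\<close> of \<open>J1\<close>. Expiry by \<open>?T\<close> rests on
      \<open>D \<le> 2 * m\<close>.\<close>
    obtain \<sigma>' where \<sigma>': "assignment J1 \<sigma>'" using sched[of 0] by auto
    show ?thesis
      by (rule remaining_expired[OF unit _ \<sigma>'])
        (use that J(2) settled_release[OF st that] D in \<open>auto simp: J1_def\<close>)
  qed
  have fin: "finite (f ` ?Q)" using finite_path_slots by simp
  \<comment> \<open>Double counting: only path jobs have work left, and each has one end among the
    \<open>s i\<close> and one among the \<open>c k\<close>.\<close>
  have "real m * (\<beta> + 1) = (\<Sum>v\<in>s ` {1..m}. \<beta> + 1)"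
    using s(1) by (simp add: card_image)
  also have "\<dots> \<le> (\<Sum>v\<in>s ` {1..m}. lag J1 ?T v)"
    by (rule sum_mono) (use src in auto)
  also have "\<dots> = (\<Sum>v\<in>s ` {1..m}. \<Sum>j | j \<in> f ` ?Q \<and> src j = v. remaining J1 ?T j)"
  proof (rule sum.cong[OF refl])
    fix v assume v: "v \<in> s ` {1..m}"
    have "at_node v (f q) \<longleftrightarrow> src (f q) = v" if "q \<in> ?Q" for q
    proof -
      obtain i r t where q: "q = (i, r, t)" by (cases q)
      obtain i' where "v = s i'" "1 \<le> i'" "i' \<le> m" using v by auto
      then have "c (d i r) \<noteq> v" using slot(4)[OF that[unfolded q]] ne[of i' "d i r"] by simp
      then show ?thesis by (simp add: q f_def)
    qed
    then show "lag J1 ?T v = (\<Sum>j | j \<in> f ` ?Q \<and> src j = v. remaining J1 ?T j)"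
      unfolding lag_def
      by (intro sum.mono_neutral_right) (use unit expired in \<open>auto simp: unit_jobs_def J1_def at_node_def\<close>)
  qed
  also have "\<dots> = (\<Sum>j\<in>f ` ?Q. remaining J1 ?T j)"
    by (rule sum.group[OF fin]) (use slot in \<open>auto simp: f_def\<close>)
  also have "\<dots> = (\<Sum>v\<in>c ` {..m}. \<Sum>j | j \<in> f ` ?Q \<and> dst j = v. remaining J1 ?T j)"
    by (rule sum.group[OF fin, symmetric]) (use slot in \<open>auto simp: f_def\<close>)
  also have "\<dots> \<le> (\<Sum>v\<in>c ` {..m}. lag J1 ?T v)"
    unfolding lag_def
    by (intro sum_mono sum_mono2)
      (use unit in \<open>auto simp: unit_jobs_def J1_def at_node_def remaining_nonneg\<close>)
  also have "\<dots> = (\<Sum>k\<le>m. lag J1 ?T (c k))"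
    by (subst sum.reindex) (auto intro: inj_on_subset[OF c(1)])
  finally have total: "real m * (\<beta> + 1) \<le> (\<Sum>k\<le>m. lag J1 ?T (c k))" .
  have "\<exists>k\<le>m. real m * (\<beta> + 1) / real (m + 1) \<le> lag J1 ?T (c k)"
  proof (rule ccontr)
    assume "\<not> ?thesis"
    then have "(\<Sum>k\<le>m. lag J1 ?T (c k)) < (\<Sum>k\<le>m. real m * (\<beta> + 1) / real (m + 1))"
      by (intro sum_strict_mono) auto
    then show False using total by simp
  qed
  then obtain k where k: "k \<le> m" "real m * (\<beta> + 1) / real (m + 1) \<le> lag J1 ?T (c k)" by blast
  obtain \<sigma>' where \<sigma>': "assignment J1 \<sigma>'" "\<forall>j\<in>J. \<sigma>' j = \<sigma> j" "\<forall>q\<in>?Q. \<sigma>' (f q) = T + path_round m k q"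
    using sched[OF k(1)] by auto
  \<comment> \<open>The schedule for \<open>k\<close> may still use round \<open>?T\<close>, so
    settling takes one round more. The job \<open>w\<close> to the spare node
    \<open>c (m + 1)\<close> offsets the unit that \<open>c k\<close> may lose in it; offline, both
    ends are free then.\<close>
  define w where "w = unit_job (c k) (c (m + 1)) ?T"
  let ?J2 = "insert w J1"
  have "\<sigma>' j < ?T + 1" if "j \<in> J1" for j
    using that \<sigma>' J(4) path_round_bounds(3)[OF _ k(1)] unfolding J1_def
    by (fastforce simp: less_Suc_eq_le simp del: path_round.simps)
  moreover have free: "\<sigma>' j \<noteq> ?T" if j: "j \<in> J1" "at_node v j" "v = c k \<or> v = c (m + 1)" for j v
  proof (cases "j \<in> J")
    case True then show ?thesis using \<sigma>'(2) J(4) by fastforce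
  next
    case False
    then obtain i r t where q: "(i, r, t) \<in> ?Q" "j = f (i, r, t)" using j(1) unfolding J1_def by auto
    have "d i r = k"
      using j(2,3) q(2) slot[OF q(1)] k(1) ne[of i k] ne[of i "m + 1"]
        c_eq[of "d i r" k] c_eq[of "d i r" "m + 1"]
      by (auto simp: f_def)
    then have "i = (if r then k else Suc k)" using slot[OF q(1)] by (auto simp: d_def)
    then show ?thesis using path_round_free_sink[OF q(1) _ k(1)] \<sigma>'(3) q by auto
  qed
  moreover have wnew: "w \<notin> J1"
    using settled_release[OF st, of w] slot ne k(1)
    by (fastforce simp: J1_def w_def f_def)
  moreover have "assignment ?J2 (\<sigma>'(w := ?T))"
  proof -
    have "\<sigma>' j \<noteq> ?T" "?T \<noteq> \<sigma>' j" if "j \<in> J1" "at_node v j" "at_node v w" for j v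
      using free[of j v] that by (auto simp: w_def)
    moreover have "release w = ?T" by (simp add: w_def)
    ultimately show ?thesis
      using \<sigma>'(1) wnew unfolding assignment_def by (auto simp del: One_nat_def)
  qed
  moreover have unit2: "unit_jobs n ?J2"
    using unit c(2) c_eq[of k "m + 1"] k(1) by (auto simp: unit_jobs_def w_def image_subset_iff)
  ultimately have "settled ?J2 (?T + 1)"
    unfolding settled_def using J(2)
    by (intro conjI exI[of _ "\<sigma>'(w := ?T)"]) (auto simp: J1_def)
  moreover have "lag J1 ?T (c k) + real 1 \<le> lag ?J2 (?T + 1) (c k) + real (?T + 1 - ?T)"
  proof (rule lag_extend[OF unit2])
    have "{j \<in> ?J2 - J1. at_node (c k) j} = {w}" using wnew by (auto simp: w_def)
    then show "1 \<le> card {j \<in> ?J2 - J1. at_node (c k) j}" by simp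
  qed (use c(2) k(1) in \<open>auto simp: w_def image_subset_iff\<close>)
  moreover have "c k < n" using c(2) k(1) by (simp add: image_subset_iff)
  ultimately show ?thesis using k(2) by (intro exI[of _ ?J2] exI[of _ "?T + 1"] exI[of _ "c k"]) simp
qed

lemma lag_step:
  assumes st: "settled J T" and v: "v < n" "\<beta> \<le> lag J T v"
    and m: "1 \<le> m" "2 * m + 2 \<le> n" "D \<le> 2 * m"
  shows "\<exists>J' T' v'. settled J' T' \<and> v' < n \<and> real m * (\<beta> + 1) / real (m + 1) \<le> lag J' T' v'"
proof -
  obtain J' T' W where W: "settled J' T'" "W \<subseteq> {..<n}" "card W = m" "\<forall>w\<in>W. \<beta> \<le> lag J' T' w"
    using lag_spread[OF st v, of m] m by auto
  have fin: "finite W" using W(2) finite_subset by blast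
  have "card {1..m} = card W" using W(3) by simp
  then obtain s where s: "bij_betw s {1..m} W"
    using fin finite_same_card_bij by blast
  \<comment> \<open>Beside \<open>W\<close>, \<open>m + 1\<close> path nodes and one spare node are
    needed.\<close>
  have "card {..m + 1} \<le> card ({..<n} - W)"
    using W(2,3) fin m by (simp add: card_Diff_subset)
  then obtain c where c: "c ` {..m + 1} \<subseteq> {..<n} - W" "inj_on c {..m + 1}"
    by (metis card_le_inj finite_Diff finite_lessThan finite_atMost)
  show ?thesis
    by (rule lag_gain[OF W(1) m(3), of s c])
      (use s c W(2,4) in \<open>auto simp: bij_betw_def\<close>)
qed

lemma lag_unbounded:
  assumes st: "settled J T" and m: "1 \<le> m" "2 * m + 2 \<le> n" "D \<le> 2 * m" and k: "k \<le> m"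
  shows "\<exists>J' T' v. settled J' T' \<and> v < n \<and> real k / 2 \<le> lag J' T' v"
  using k
proof (induction k)
  case 0
  show ?case using st m lag_nonneg by (intro exI[of _ J] exI[of _ T] exI[of _ 0]) auto
next
  case (Suc k)
  then obtain J' T' v where *: "settled J' T'" "v < n" "real k / 2 \<le> lag J' T' v" by auto
  obtain J'' T'' v' where **: "settled J'' T''" "v' < n"
      "real m * (real k / 2 + 1) / real (m + 1) \<le> lag J'' T'' v'"
    using lag_step[OF * m] by blast
  \<comment> \<open>Amounts to \<open>Suc k \<le> m\<close>: the gain
    \<open>(m - \<beta>) / (m + 1)\<close> is at least 1/2 at
    \<open>\<beta> = k / 2\<close>.\<close>
  have "real (Suc k) * real (m + 1) \<le> real m * (real k + 2)"
    using Suc.prems by (simp add: algebra_simps)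
  then have "real (Suc k) / 2 \<le> real m * (real k / 2 + 1) / real (m + 1)"
    by (simp add: field_simps)
  then show ?case using ** by (meson order_trans)
qed

lemma deadline_ge:
  assumes "settled J T" "1 \<le> m" "2 * m + 2 \<le> n"
  shows "m \<le> 2 * D"
proof (rule ccontr)
  assume "\<not> m \<le> 2 * D"
  moreover from this obtain J' T' v where "settled J' T'" "v < n" "real m / 2 \<le> lag J' T' v"
    using lag_unbounded[OF assms, of m] by auto
  ultimately show False using lag_le_deadline by fastforce
qed

end

section \<open>From a slow job to the competitive ratio\<close>

theorem theorem1:
  "\<exists>c::real. 0 < c \<and> (\<exists>n0::nat. \<forall>A. online_algorithm A \<longrightarrow>
     (\<forall>n\<ge>n0. \<exists>I. valid_instance I \<and> card (nodes I) = n \<and>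
        (\<forall>v\<in>nodes I. capacity I v = 1) \<and> (\<forall>j\<in>jobs I. demand j = 1) \<and>
        0 < opt_unsplit I \<and> opt_unsplit I < \<infinity> \<and>
        ereal (c * real n) * ereal_of_enat (opt_unsplit I)
          \<le> ereal_of_enat (max_response I (run A I))))"
proof (intro exI[of _ "1 / 16 :: real"] conjI exI[of _ "8 :: nat"] allI impI)
  fix A n assume A: "online_algorithm A" and n: "8 \<le> (n::nat)"
  \<comment> \<open>The largest \<open>m\<close> with \<open>2 * m + 2 \<le> n\<close>, and the
    largest \<open>D\<close> with \<open>2 * D < m\<close>, which \<open>deadline_ge\<close> rules
    out.\<close>
  define m where "m = (n - 2) div 2"
  define D where "D = (m - 1) div 2"
  define p where "p = unit_job 0 1 0"
  define q where "q = unit_job 0 1 0\<lparr>tag := 1\<rparr>"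
  have m: "1 \<le> m" "2 * m + 2 \<le> n" "m > 2 * D" "n \<le> 8 * (D + 1)"
    using n unfolding m_def D_def by presburger+
  have pq: "p \<noteq> q" "tag q = 1" "src q = 0" "dst q = 1" "demand q = 1" "release q = 0"
    by (auto simp: p_def q_def unit_job_def)
  define good where "good = (\<lambda>J. unit_jobs n J \<and> {p, q} \<subseteq> J \<and> (\<exists>\<sigma>. assignment J \<sigma>))"
  \<comment> \<open>The parallel jobs \<open>p\<close> and \<open>q\<close> only serve to make the optimum positive.\<close>
  have "\<exists>J j. good J \<and> j \<in> J \<and> (\<Sum>s\<le>release j + D. run A (unit_instance n J) s j) < 1"
  proof (rule ccontr)
    assume contr: "\<not> ?thesis"
    interpret prompt_algorithm A n D "{p, q}"
      by unfold_locales (use A contr in \<open>force simp: good_def\<close>)+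
    \<comment> \<open>The witness \<open>tag\<close> puts \<open>p\<close> into round 0 and
      \<open>q\<close> into round 1.\<close>
    have "settled {p, q} 2"
      unfolding settled_def assignment_def
      using n pq by (auto simp: unit_jobs_def p_def intro!: exI[of _ tag])
    then show False using deadline_ge m by fastforce
  qed
  then obtain J j where J: "unit_jobs n J" "p \<in> J" "q \<in> J" "j \<in> J"
      and slow: "(\<Sum>s\<le>release j + D. run A (unit_instance n J) s j) < 1"
      and "\<exists>\<sigma>. assignment J \<sigma>"
    by (auto simp: good_def)
  let ?I = "unit_instance n J" and ?x = "run A (unit_instance n J)"
  have opt2: "opt_unsplit ?I \<le> 2" using J(1) \<open>\<exists>\<sigma>. assignment J \<sigma>\<close> opt_unsplit_le_2 by blast
  have opt0: "0 < opt_unsplit ?I"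
    by (rule opt_unsplit_pos[of J n p q])
      (use J n pq in \<open>auto simp: unit_jobs_def at_node_def p_def\<close>)
  have "feasible ?I ?x" using A J(1) valid_unit_instance by (auto simp: online_algorithm_def)
  then have nonneg: "0 \<le> ?x s j" for s using J(4) by (auto simp: feasible_def unit_instance_def)
  \<comment> \<open>Also covers a job that is never finished, whose completion is the infimum of the
    empty set.\<close>
  have "enat (release j + D + 1) \<le> completion ?x j"
    unfolding completion_def
  proof (rule INF_greatest)
    fix t assume t: "t \<in> {t. real (demand j) \<le> (\<Sum>s\<le>t. ?x s j)}"
    have "\<not> t \<le> release j + D"
    proof
      assume "t \<le> release j + D"
      then have "(\<Sum>s\<le>t. ?x s j) \<le> (\<Sum>s\<le>release j + D. ?x s j)"
        by (intro sum_mono2) (auto simp: nonneg)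
      then show False using t slow J(1,4) by (auto simp: unit_jobs_def)
    qed
    then show "enat (release j + D + 1) \<le> enat t" by simp
  qed
  then have "enat (D + 1) \<le> response ?x j"
    by (cases "completion ?x j") (auto simp: response_def)
  also have "\<dots> \<le> max_response ?I ?x"
    unfolding max_response_def by (rule SUP_upper) (use J(4) in \<open>simp add: unit_instance_def\<close>)
  finally have resp: "ereal_of_enat (enat (D + 1)) \<le> ereal_of_enat (max_response ?I ?x)"
    by (simp only: ereal_of_enat_le_iff)
  obtain r where r: "opt_unsplit ?I = enat r" "r \<le> 2"
    using opt2 by (cases "opt_unsplit ?I") (auto simp: numeral_eq_enat)
  \<comment> \<open>An optimum of at most 2 and \<open>n \<le> 8 * (D + 1)\<close> yield the
    constant 1/16.\<close>
  have "1 / 16 * real n * real r \<le> 1 / 16 * real n * 2"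
    using r(2) by (intro mult_left_mono) auto
  also have "\<dots> \<le> real (D + 1)" using m(4) by simp
  finally have "ereal (1 / 16 * real n) * ereal_of_enat (opt_unsplit ?I) \<le> ereal_of_enat (enat (D + 1))"
    by (simp add: r(1))
  then have bound: "ereal (1 / 16 * real n) * ereal_of_enat (opt_unsplit ?I)
      \<le> ereal_of_enat (max_response ?I ?x)"
    using resp by (rule order_trans)
  show "\<exists>I. valid_instance I \<and> card (nodes I) = n \<and>
        (\<forall>v\<in>nodes I. capacity I v = 1) \<and> (\<forall>j\<in>jobs I. demand j = 1) \<and>
        0 < opt_unsplit I \<and> opt_unsplit I < \<infinity> \<and>
        ereal (1 / 16 * real n) * ereal_of_enat (opt_unsplit I)
          \<le> ereal_of_enat (max_response I (run A I))"
  proof (intro exI[of _ ?I] conjI)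
    show "opt_unsplit ?I < \<infinity>" using r by simp
    show "\<forall>j\<in>jobs ?I. demand j = 1" using J(1) by (simp add: unit_jobs_def unit_instance_def)
  qed (use valid_unit_instance[OF J(1)] opt0 bound in \<open>simp_all add: unit_instance_def\<close>)
qed simp

end
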